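(* Let $\ell\le 0\le r$ be integers and let $(n_i)_{\ell\le i\le r}$ be a sequence of positive integers. The number of binary trees (canonically embedded as described in the context) having vertical profile $(n_\ell,\ldots,n_{-1};n_0,n_1,\ldots,n_r)$ is $$\frac{n_0}{n_\ell n_r}\binom{n_{-1}+n_1}{n_0-1}\prod_{\substack{\ell\le i\le r\\ i\neq 0}}\binom{n_{i-1}+n_{i+1}-1}{n_i-1},$$ with the convention $n_{\ell-1}=n_{r+1}=0$.
   Context: A rooted binary tree is a rooted plane tree in which each node has at most one left child and at most one right child. Its nodes are canonically embedded in $\mathbb{Z}$: the root gets abscissa $0$, and if a node has abscissa $i$, its left child (if any) has abscissa $i-1$ and its right child (if any) has abscissa $i+1$. The vertical profile of the tree is $(n_\ell,\ldots,n_{-1};n_0,n_1,\ldots,n_r)$, where $n_i$ is the number of nodes with abscissa $i$, and $\ell$ (resp. $r$) is the smallest (resp. largest) abscissa of a node. *)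

theory Defs
  imports Complex_Main "HOL-Library.Tree" "HOL-Library.Multiset"
begin

(* Binary trees are unlabelled, hence values of type unit tree; Leaf stands for an absent
   child, so only Node constructors are nodes. The first argument is the abscissa of the root. *)
fun abscissae_from :: "int \<Rightarrow> 'a tree \<Rightarrow> int multiset" where
  "abscissae_from x Leaf = {#}"
| "abscissae_from x (Node lt a rt) =
     add_mset x (abscissae_from (x - 1) lt + abscissae_from (x + 1) rt)"

definition abscissae :: "'a tree \<Rightarrow> int multiset" where
  "abscissae t = abscissae_from 0 t"

definition has_vertical_profile :: "'a tree \<Rightarrow> int \<Rightarrow> int \<Rightarrow> (int \<Rightarrow> nat) \<Rightarrow> bool" where
  "has_vertical_profile t l r n \<longleftrightarrow>
     t \<noteq> Leaf \<and>
     Min (set_mset (abscissae t)) = l \<and>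
     Max (set_mset (abscissae t)) = r \<and>
     (\<forall>i\<in>{l..r}. count (abscissae t) i = n i)"

end

theory Submission
  imports Defs
begin

text \<open>
  Explore a forest from a list of open slots, each of which is either left empty or filled by a
  node that opens two new slots. Let \<open>n i\<close> be the number of nodes and \<open>m i\<close> the number of slots
  ever opened at abscissa \<open>i\<close>. If every word of fillings succeeded, there would be
  \<open>\<Prod>i. m i choose n i\<close> forests. The fraction of successful words is the tridiagonal determinant
  with unit diagonal and entries \<open>- n i / m i\<close> next to the diagonal in column \<open>i\<close>: it is
  affine in each column, so exploring one slot preserves its mean, and it vanishes when no slot
  is open but nodes remain, because the vector \<open>m\<close> then lies in the kernel. For a single slot at
  abscissa 0 this determinant is a product.
\<close>

section \<open>Tridiagonal determinants\<close>

text \<open>Determinant of order \<open>j\<close> on the indices \<open>a, ..., a + j - 1\<close>,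
  with diagonal 1 and off-diagonal entries \<open>- q i\<close> in column \<open>i\<close>. The
  recurrence is the expansion along the last row.\<close>

fun continuant :: "(int \<Rightarrow> real) \<Rightarrow> int \<Rightarrow> nat \<Rightarrow> real" where
  "continuant q a 0 = 1"
| "continuant q a (Suc 0) = 1"
| "continuant q a (Suc (Suc j)) =
     continuant q a (Suc j) - q (a + int j) * q (a + int j + 1) * continuant q a j"

lemma continuant_cong:
  "(\<And>i. a \<le> i \<Longrightarrow> i < a + int j \<Longrightarrow> q i = q' i) \<Longrightarrow> continuant q a j = continuant q' a j"
proof (induction q a j rule: continuant.induct)
  case (3 q a j)
  have "continuant q a (Suc j) = continuant q' a (Suc j)" "continuant q a j = continuant q' a j"
    by (rule 3; use "3.prems" in simp)+
  moreover have "q (a + int j) = q' (a + int j)" "q (a + int j + 1) = q' (a + int j + 1)"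
    by (rule "3.prems"; simp)+
  ultimately show ?case
    by simp
qed simp_all

text \<open>The entry \<open>q p\<close> occurs in column \<open>p\<close> only, and a determinant
  is linear in each column.\<close>

lemma continuant_affine:
  "\<exists>A B. \<forall>x. continuant (q(p := x)) a j = A + x * B"
proof (induction q a j rule: continuant.induct)
  case (1 q a)
  show ?case by (rule exI[of _ 1], rule exI[of _ 0]) simp
next
  case (2 q a)
  show ?case by (rule exI[of _ 1], rule exI[of _ 0]) simp
next
  case (3 q a j)
  obtain A B where AB: "\<And>x. continuant (q(p := x)) a (Suc j) = A + x * B"
    using 3 by blast
  obtain A' B' where AB': "\<And>x. continuant (q(p := x)) a j = A' + x * B'"
    using 3 by blast
  \<comment> \<open>Only indices below \<open>a + int j\<close> enter
    \<open>continuant q a j\<close>, so the recurrence never multiplies \<open>x\<close> by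
    itself.\<close>
  have indep: "continuant (q(p := x)) a j = continuant q a j" if "p \<ge> a + int j" for x
    by (rule continuant_cong) (use that in auto)
  consider "p = a + int j" | "p = a + int j + 1" | "p \<noteq> a + int j" "p \<noteq> a + int j + 1"
    by blast
  then show ?case
  proof cases
    case 1
    have "continuant (q(p := x)) a (Suc (Suc j)) =
        A + x * (B - q (a + int j + 1) * continuant q a j)" for x
      using 1 indep AB[of x] by (simp add: algebra_simps)
    then show ?thesis by blast
  next
    case 2
    have "continuant (q(p := x)) a (Suc (Suc j)) =
        A + x * (B - q (a + int j) * continuant q a j)" for x
      using 2 indep AB[of x] by (simp add: algebra_simps)
    then show ?thesis by blast
  next
    case 3
    have "continuant (q(p := x)) a (Suc (Suc j)) =
        (A - q (a + int j) * q (a + int j + 1) * A')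
        + x * (B - q (a + int j) * q (a + int j + 1) * B')" for x
      using 3 by (simp add: AB AB' algebra_simps)
    then show ?thesis by blast
  qed
qed

text \<open>The recurrence uses \<open>q p\<close> only in products with a neighbour, and both
  neighbours vanish. This covers the exploration of the only slot at \<open>p\<close>, after which
  the ratio at \<open>p\<close> is a division by 0.\<close>

lemma continuant_upd_isolated:
  assumes "q (p - 1) = 0" and "q (p + 1) = 0"
  shows "continuant (q(p := x)) a j = continuant q a j"
  using assms
proof (induction q a j rule: continuant.induct)
  case (3 q a j)
  have "(q(p := x)) (a + int j) * (q(p := x)) (a + int j + 1) =
      q (a + int j) * q (a + int j + 1)"
    using "3.prems" by auto
  then show ?case
    using 3 by simp
qed auto

text \<open>Where \<open>q\<close> vanishes the columns are unit vectors, so enlarging the matrix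
  leaves the determinant unchanged.\<close>

lemma continuant_extend_zero:
  assumes "continuant q a (Suc j) = 0" and "\<And>i. i > a + int j \<Longrightarrow> q i = 0"
  shows "continuant q a (Suc j + e) = 0"
proof (induction e)
  case 0
  show ?case using assms by simp
next
  case (Suc e)
  have "q (a + int (j + e) + 1) = 0"
    using assms(2) by simp
  then show ?case
    using Suc by simp
qed

text \<open>The numerator in Cramer's rule: the determinant on \<open>a, ..., a + j\<close> with its
  last column replaced by \<open>k\<close>. A source \<open>k i\<close> enters with the continuant
  to its left as weight and gains a factor \<open>q\<close> with each further index.\<close>

fun kernel_defect :: "(int \<Rightarrow> real) \<Rightarrow> (int \<Rightarrow> real) \<Rightarrow> int \<Rightarrow> nat \<Rightarrow> real" where
  "kernel_defect q k a 0 = k a"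
| "kernel_defect q k a (Suc j) =
     q (a + int j) * kernel_defect q k a j + k (a + int j + 1) * continuant q a (Suc j)"

text \<open>
  Cramer's rule for the tridiagonal system \<open>m i - q (i - 1) * m (i - 1) - q (i + 1) * m (i + 1) = k i\<close>.
\<close>

lemma continuant_mult_solution:
  fixes m n k q :: "int \<Rightarrow> real"
  assumes "\<And>i. i \<ge> a \<Longrightarrow> i < a + int j \<Longrightarrow> q i * m i = n i"
    and "\<And>i. i \<ge> a \<Longrightarrow> i \<le> a + int j \<Longrightarrow> m i = k i + n (i - 1) + n (i + 1)"
    and "n (a - 1) = 0"
    and "q (a + int j) * m (a + int j) = n (a + int j)"
  shows "continuant q a (Suc j) * m (a + int j) =
    n (a + int j + 1) * continuant q a j + kernel_defect q k a j"
  using assms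
proof (induction j)
  case 0
  then show ?case by simp
next
  case (Suc j)
  let ?i = "a + int j"
  have IH: "continuant q a (Suc j) * m ?i =
      n (?i + 1) * continuant q a j + kernel_defect q k a j"
    by (rule Suc.IH) (use Suc.prems in auto)
  have q: "q ?i * m ?i = n ?i" "q (?i + 1) * m (?i + 1) = n (?i + 1)"
    using Suc.prems(1)[of ?i] Suc.prems(4) by (auto simp: add_ac)
  have m: "m (?i + 1) = k (?i + 1) + n ?i + n (?i + 2)"
    using Suc.prems(2)[of "?i + 1"] by (simp add: add.assoc)
  have "continuant q a (Suc (Suc j)) * m (?i + 1) =
      continuant q a (Suc j) * m (?i + 1) - q ?i * (q (?i + 1) * m (?i + 1)) * continuant q a j"
    by (simp add: algebra_simps)
  \<comment> \<open>The induction hypothesis trades the continuant of order \<open>j\<close> for the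
    one of order \<open>Suc j\<close>, so that \<open>q ?i * m ?i = n ?i\<close> cancels a term of
    the equation for \<open>m (?i + 1)\<close>.\<close>
  also have "\<dots> = continuant q a (Suc j) * m (?i + 1)
      - q ?i * (continuant q a (Suc j) * m ?i - kernel_defect q k a j)"
    using IH q(2) by (simp add: algebra_simps)
  also have "\<dots> = continuant q a (Suc j) * (m (?i + 1) - q ?i * m ?i)
      + q ?i * kernel_defect q k a j"
    by (simp add: algebra_simps)
  also have "\<dots> = n (?i + 2) * continuant q a (Suc j) + kernel_defect q k a (Suc j)"
    unfolding q(1) m by (simp add: algebra_simps)
  finally show ?case
    by (simp add: add_ac)
qed

section \<open>Forests grown from a list of slots\<close>

text \<open>Each slot carries one tree rooted at its abscissa, with \<open>Leaf\<close> for a slot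
  left empty. \<open>N\<close> collects the abscissae of all nodes together.\<close>

definition forests :: "int list \<Rightarrow> int multiset \<Rightarrow> unit tree list set" where
  "forests ps N =
     {ts. length ts = length ps \<and> sum_list (map2 abscissae_from ps ts) = N}"

lemma forests_Nil: "forests [] N = (if N = {#} then {[]} else {})"
  by (auto simp: forests_def)

definition join_root :: "unit tree list \<Rightarrow> unit tree list" where
  "join_root ts = Node (ts ! 0) () (ts ! 1) # drop 2 ts"

text \<open>Exploring the first slot either leaves it empty or puts a node there, whose two child
  positions become the first two slots; \<open>join_root\<close> reverses the latter.\<close>

lemma forests_Cons:
  "forests (p # ps) N = (#) Leaf ` forests ps N \<union>
     (if p \<in># N then join_root ` forests ((p - 1) # (p + 1) # ps) (N - {#p#}) else {})"
  (is "?A = ?B")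
proof (intro set_eqI iffI)
  fix ts assume ts: "ts \<in> ?A"
  then obtain t us where [simp]: "ts = t # us" by (cases ts) (auto simp: forests_def)
  show "ts \<in> ?B"
  proof (cases t)
    case Leaf
    then show ?thesis using ts by (auto simp: forests_def)
  next
    case (Node x u y)
    then have "x # y # us \<in> forests ((p - 1) # (p + 1) # ps) (N - {#p#})" and "p \<in># N"
      using ts by (auto simp: forests_def add.assoc)
    moreover have "ts = join_root (x # y # us)"
      using Node by (simp add: join_root_def)
    ultimately show ?thesis by auto
  qed
next
  fix ts assume ts: "ts \<in> ?B"
  then consider us where "ts = Leaf # us" "us \<in> forests ps N"
    | us where "p \<in># N" "ts = join_root us"
        "us \<in> forests ((p - 1) # (p + 1) # ps) (N - {#p#})"
    by (auto split: if_splits)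
  then show "ts \<in> ?A"
  proof cases
    case 1
    then show ?thesis by (auto simp: forests_def)
  next
    case 2
    then obtain x y vs where "us = x # y # vs"
      by (auto simp: forests_def length_Suc_conv)
    with 2 show ?thesis
      by (auto simp: forests_def join_root_def add.assoc[symmetric]
          dest!: multi_member_split)
  qed
qed

lemma inj_on_join_root: "inj_on join_root (forests (p # p' # ps) N)"
proof (rule inj_onI)
  fix ts us
  assume "ts \<in> forests (p # p' # ps) N" "us \<in> forests (p # p' # ps) N"
  then have "length ts = Suc (Suc (length ps))" "length us = Suc (Suc (length ps))"
    by (simp_all add: forests_def)
  then obtain x y ts' x' y' us' where "ts = x # y # ts'" "us = x' # y' # us'"
    by (auto simp: length_Suc_conv)
  then show "join_root ts = join_root us \<Longrightarrow> ts = us"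
    by (simp add: join_root_def)
qed

lemma finite_forests: "finite (forests ps N)"
\<comment> \<open>Filling a slot uses up one node and increases the number of slots by one, so nodes
  get weight 2.\<close>
proof (induction "2 * size N + length ps" arbitrary: ps N rule: less_induct)
  case less
  show ?case
  proof (cases ps)
    case Nil
    then show ?thesis by (simp add: forests_Nil)
  next
    case (Cons p ps')
    have "finite (forests ps' N)"
      by (rule less) (simp add: Cons)
    moreover have "finite (forests ((p - 1) # (p + 1) # ps') (N - {#p#}))" if "p \<in># N"
      by (rule less) (use that Cons in \<open>auto simp: size_Diff_singleton dest!: multi_member_split\<close>)
    ultimately show ?thesis
      by (simp add: Cons forests_Cons[of p ps'])
  qed
qed

lemma card_forests_Cons:
  "card (forests (p # ps) N) = card (forests ps N) +
     (if p \<in># N then card (forests ((p - 1) # (p + 1) # ps) (N - {#p#})) else 0)"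
proof -
  have "(#) Leaf ` forests ps N \<inter>
      join_root ` forests ((p - 1) # (p + 1) # ps) (N - {#p#}) = {}"
    by (auto simp: join_root_def)
  then show ?thesis
    by (auto simp: forests_Cons[of p ps] card_Un_disjoint finite_forests card_image inj_on_join_root)
qed

section \<open>The number of forests\<close>

text \<open>All slots ever opened at \<open>i\<close>: those open now, the right child positions of
  nodes at \<open>i - 1\<close>, and the left child positions of nodes at
  \<open>i + 1\<close>.\<close>

definition slots :: "int list \<Rightarrow> int multiset \<Rightarrow> int \<Rightarrow> nat" where
  "slots ps N i = count (mset ps) i + count N (i - 1) + count N (i + 1)"

text \<open>This is 0 where there are no slots, by the convention \<open>x / 0 = 0\<close>.\<close>

definition node_ratio :: "int list \<Rightarrow> int multiset \<Rightarrow> int \<Rightarrow> real" where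
  "node_ratio ps N i = real (count N i) / real (slots ps N i)"

text \<open>Pascal's rule splits the binomial with weights \<open>1 - n / m\<close> and
  \<open>n / m\<close>. Under these weights the new ratios \<open>n / (m - 1)\<close> and
  \<open>(n - 1) / (m - 1)\<close> have mean \<open>n / m\<close>, and an affine \<open>K\<close>
  preserves means. For \<open>m = 1\<close> both new ratios default to 0, so \<open>K\<close> has to
  be constant.\<close>

lemma binomial_average:
  fixes K :: "real \<Rightarrow> real"
  assumes "m > 0" "n > 0" and K: "\<And>x. K x = A + x * B" and "m = 1 \<Longrightarrow> B = 0"
  shows "real (m choose n) * K (real n / real m) =
    real ((m - 1) choose n) * K (real n / real (m - 1)) +
    real ((m - 1) choose (n - 1)) * K (real (n - 1) / real (m - 1))"
proof (cases "m = 1")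
  case True
  then show ?thesis
    using assms by (cases "n = 1") (auto simp: binomial_eq_0)
next
  case False
  obtain m' n' where mn: "m = Suc m'" "n = Suc n'"
    using assms by (metis gr0_implies_Suc)
  have m': "real m' > 0" using False mn by auto
  have a: "real (m' choose n') = real n / real m * real (m choose n)"
    using Suc_times_binomial_eq[of m' n'] unfolding mn
    by (simp add: field_simps flip: of_nat_mult)
  have b: "real (m' choose n) = real (m choose n) - real (m' choose n')"
    unfolding mn by simp
  have avg: "c * (A + (x + 1) / (y + 1) * B) =
      (c - (x + 1) / (y + 1) * c) * (A + (x + 1) / y * B) + (x + 1) / (y + 1) * c * (A + x / y * B)"
    if "y > 0" for c x y :: real
    using that by (simp add: divide_simps) (simp add: algebra_simps)
  have "real (m choose n) * K (real n / real m) =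
      (real (m choose n) - real n / real m * real (m choose n)) * K (real n / real m') +
      real n / real m * real (m choose n) * K (real n' / real m')"
    using avg[OF m', of "real (m choose n)" "real n'"] by (simp add: K mn add.commute)
  then show ?thesis
    unfolding b[symmetric, unfolded a] a[symmetric] using mn by simp
qed

text \<open>Exploring a slot at \<open>p\<close> alters one binomial factor and one column, so
  \<open>binomial_average\<close> applies with the determinant as a function of \<open>q p\<close>.
  The two summands stand for an empty and a filled slot.\<close>

lemma forest_formula_step:
  fixes m n :: "int \<Rightarrow> nat"
  defines "q \<equiv> \<lambda>i. real (n i) / real (m i)"
  assumes p: "p \<in> {a..<a + int d}" and pos: "m p > 0" "n p > 0"
    and isolated: "m p = 1 \<Longrightarrow> n (p - 1) = 0 \<and> n (p + 1) = 0"
  defines "m' \<equiv> m(p := m p - 1)" and "n' \<equiv> n(p := n p - 1)"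
  shows "(\<Prod>i\<in>{a..<a + int d}. real (m i choose n i)) * continuant q a d =
    (\<Prod>i\<in>{a..<a + int d}. real (m' i choose n i)) *
      continuant (\<lambda>i. real (n i) / real (m' i)) a d +
    (\<Prod>i\<in>{a..<a + int d}. real (m' i choose n' i)) *
      continuant (\<lambda>i. real (n' i) / real (m' i)) a d"
proof -
  let ?I = "{a..<a + int d}"
  define R where "R = (\<Prod>i\<in>?I - {p}. real (m i choose n i))"
  obtain A B where AB: "\<And>x. continuant (q(p := x)) a d = A + x * B"
    using continuant_affine by blast
  have "B = 0" if "m p = 1"
  proof -
    have "continuant (q(p := x)) a d = continuant q a d" for x
      by (rule continuant_upd_isolated) (use isolated[OF that] in \<open>auto simp: q_def\<close>)
    from this[of 0] this[of 1] show ?thesis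
      unfolding AB by simp
  qed
  moreover have "q(p := real (n p) / real (m p)) = q"
    by (auto simp: q_def)
  ultimately have avg: "real (m p choose n p) * continuant q a d =
      real ((m p - 1) choose n p) * continuant (q(p := real (n p) / real (m p - 1))) a d +
      real ((m p - 1) choose (n p - 1)) *
        continuant (q(p := real (n p - 1) / real (m p - 1))) a d"
    using binomial_average[of "m p" "n p" "\<lambda>x. continuant (q(p := x)) a d", OF pos AB]
    by metis
  have prods: "(\<Prod>i\<in>?I. real (m i choose n i)) = real (m p choose n p) * R"
    "(\<Prod>i\<in>?I. real (m' i choose n i)) = real ((m p - 1) choose n p) * R"
    "(\<Prod>i\<in>?I. real (m' i choose n' i)) = real ((m p - 1) choose (n p - 1)) * R"
    unfolding R_def prod.remove[OF finite_atLeastLessThan_int p] m'_def n'_def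
    by (auto intro!: prod.cong)
  have ratios: "(\<lambda>i. real (n i) / real (m' i)) = q(p := real (n p) / real (m p - 1))"
    "(\<lambda>i. real (n' i) / real (m' i)) = q(p := real (n p - 1) / real (m p - 1))"
    by (auto simp: q_def m'_def n'_def)
  show ?thesis
    unfolding prods ratios using avg by (simp add: algebra_simps)
qed

text \<open>A shortage of slots makes a binomial vanish. Otherwise \<open>q i * m i = n i\<close>
  holds everywhere, and \<open>m\<close> is a kernel vector because no slot is open.\<close>

lemma forest_formula_closed:
  assumes "set_mset N \<subseteq> {a..<a + int d}" and "N \<noteq> {#}"
  shows "(\<Prod>i\<in>{a..<a + int d}. real (slots [] N i choose count N i)) *
    continuant (node_ratio [] N) a d = 0"
proof (cases "\<exists>i\<in>{a..<a + int d}. slots [] N i < count N i")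
  case True
  then have "(\<Prod>i\<in>{a..<a + int d}. real (slots [] N i choose count N i)) = 0"
    by (auto simp: binomial_eq_0)
  then show ?thesis by simp
next
  case False
  have le: "count N i \<le> slots [] N i" for i
  proof (cases "i \<in># N")
    case True
    then show ?thesis using False assms(1) by (meson not_le subsetD)
  qed (simp add: not_in_iff)
  \<comment> \<open>Cutting the matrix off at the last occupied abscissa removes the boundary term,
    as \<open>n (M + 1) = 0\<close>, and leaves a factor \<open>m M > 0\<close> that can be
    cancelled.\<close>
  define M where "M = Max (set_mset N)"
  have M: "M \<in># N" and ub: "\<And>i. i > M \<Longrightarrow> count N i = 0"
    using assms(2) by (auto simp: M_def not_in_iff[symmetric] dest: Max_ge[rotated])
  define j where "j = nat (M - a)"
  have "M \<ge> a" "M < a + int d"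
    using M assms(1) by auto
  then have j: "M = a + int j" "j < d"
    by (auto simp: j_def)
  have defect: "kernel_defect q (\<lambda>_. 0) a i = 0" for q i
    by (induction i) auto
  \<comment> \<open>By \<open>le\<close>, no slots means no nodes, so the default value of the
    division does no harm.\<close>
  have ratio: "node_ratio [] N i * real (slots [] N i) = real (count N i)" for i
    using le[of i] by (cases "slots [] N i = 0") (auto simp: node_ratio_def)
  have "continuant (node_ratio [] N) a (Suc j) * real (slots [] N (a + int j)) =
      real (count N (a + int j + 1)) * continuant (node_ratio [] N) a j +
      kernel_defect (node_ratio [] N) (\<lambda>_. 0) a j"
  proof (rule continuant_mult_solution)
    have "a - 1 \<notin># N"
      using assms(1) by auto
    then show "real (count N (a - 1)) = 0"
      by (simp add: not_in_iff)
  qed (auto simp: ratio, auto simp: slots_def)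
  moreover have "slots [] N (a + int j) > 0"
    using M le[of M] unfolding j(1) by (metis count_greater_zero_iff less_le_trans)
  ultimately have "continuant (node_ratio [] N) a (Suc j) = 0"
    using ub by (simp add: defect j)
  then have "continuant (node_ratio [] N) a (Suc j + (d - Suc j)) = 0"
    by (rule continuant_extend_zero) (simp add: node_ratio_def ub j)
  then show ?thesis
    using j by simp
qed

lemma card_forests:
  assumes "set_mset N \<subseteq> {a..<a + int d}"
  shows "real (card (forests ps N)) =
    (\<Prod>i\<in>{a..<a + int d}. real (slots ps N i choose count N i)) *
    continuant (node_ratio ps N) a d"
  using assms
proof (induction "2 * size N + length ps" arbitrary: ps N rule: less_induct)
  case less
  let ?I = "{a..<a + int d}"
  show ?case
  proof (cases ps)
    case Nil
    show ?thesis
    proof (cases "N = {#}")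
      case True
      have "continuant (\<lambda>_. 0) a d = 1"
        by (induction "\<lambda>_::int. 0::real" a d rule: continuant.induct) auto
      moreover have "node_ratio [] {#} = (\<lambda>_. 0)"
        by (auto simp: node_ratio_def)
      ultimately show ?thesis
        by (simp add: Nil True forests_Nil)
    next
      case False
      then show ?thesis
        using forest_formula_closed[OF less.prems] by (simp add: Nil forests_Nil)
    qed
  next
    case (Cons p ps')
    have empty: "real (card (forests ps' N)) =
        (\<Prod>i\<in>?I. real (slots ps' N i choose count N i)) * continuant (node_ratio ps' N) a d"
      by (rule less.hyps) (use less.prems Cons in auto)
    have slots': "slots ps' N = (slots ps N)(p := slots ps N p - 1)"
      by (auto simp: slots_def Cons)
    show ?thesis
    proof (cases "p \<in># N")
      \<comment> \<open>Such a slot stays empty, possibly outside the window: its binomial is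
        \<open>m p choose 0 = 1\<close> and its ratio is 0 for any \<open>m p\<close>.\<close>
      case False
      then have n0: "count N p = 0"
        by (simp add: not_in_iff)
      have "(slots ps' N i choose count N i) = (slots ps N i choose count N i)" for i
        by (simp add: slots' n0)
      moreover have "node_ratio ps' N = node_ratio ps N"
        by (auto simp: node_ratio_def slots' n0)
      ultimately show ?thesis
        using empty False by (simp add: Cons card_forests_Cons[of p ps'])
    next
      case True
      let ?ps = "(p - 1) # (p + 1) # ps'" and ?N = "N - {#p#}"
      have filled: "real (card (forests ?ps ?N)) =
          (\<Prod>i\<in>?I. real (slots ?ps ?N i choose count ?N i)) *
          continuant (node_ratio ?ps ?N) a d"
      proof (rule less.hyps)
        show "2 * size ?N + length ?ps < 2 * size N + length ps"
          using True Cons by (auto dest!: multi_member_split)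
        show "set_mset ?N \<subseteq> ?I"
          using less.prems by (meson in_diffD subset_iff)
      qed
      have pos: "count N p > 0"
        using True by simp
      have count': "count ?N = (count N)(p := count N p - 1)"
        by auto
      \<comment> \<open>The child positions of the removed node, counted through \<open>N\<close>
        before, now stand in the list; only the explored slot at \<open>p\<close>
        disappears.\<close>
      have slots'': "slots ?ps ?N = (slots ps N)(p := slots ps N p - 1)"
        using pos by (auto simp: slots_def Cons fun_eq_iff)
      have "p \<in> ?I"
        using True less.prems by blast
      moreover have "slots ps N p > 0"
        by (simp add: slots_def Cons)
      moreover have "slots ps N p = 1 \<Longrightarrow> count N (p - 1) = 0 \<and> count N (p + 1) = 0"
        by (simp add: slots_def Cons)
      ultimately show ?thesis
        using forest_formula_step[of p a d "slots ps N" "count N"] pos True empty filled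
        unfolding node_ratio_def slots' slots'' count' by (simp add: Cons card_forests_Cons[of p ps'])
    qed
  qed
qed

section \<open>The determinant for a single slot at abscissa 0\<close>

text \<open>Left of 0 there is no source, so Cramer's rule gives a telescoping product. The source
  at 0 then travels to \<open>r\<close>, gaining one factor \<open>q\<close> at each index, and
  \<open>n (r + 1) = 0\<close> removes the boundary term.\<close>

lemma continuant_single_source:
  fixes m n q :: "int \<Rightarrow> real"
  assumes "l \<le> 0" and "0 \<le> r"
    and q: "\<And>i. l \<le> i \<Longrightarrow> i \<le> r \<Longrightarrow> q i * m i = n i"
    and m: "\<And>i. l \<le> i \<Longrightarrow> i \<le> r \<Longrightarrow> m i = (if i = 0 then 1 else 0) + n (i - 1) + n (i + 1)"
    and n: "\<And>i. l \<le> i \<Longrightarrow> i \<le> r \<Longrightarrow> n i \<noteq> 0"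
    and "n (l - 1) = 0" and "n (r + 1) = 0"
  shows "continuant q l (nat (r + 1 - l)) * (n l * n r) = n 0 * (\<Prod>i\<in>{l..r}. q i)"
proof -
  define k :: "int \<Rightarrow> real" where "k = (\<lambda>i. if i = 0 then 1 else 0)"
  define z where "z = nat (- l)"
  have z: "l + int z = 0"
    using assms(1) by (simp add: z_def)
  have solution: "continuant q l (Suc j) * m (l + int j) =
      n (l + int j + 1) * continuant q l j + kernel_defect q k l j" if "l + int j \<le> r" for j
    by (rule continuant_mult_solution) (use that q m assms(6) in \<open>auto simp: k_def\<close>)
  have upto: "{b..<b + int (Suc j)} = insert (b + int j) {b..<b + int j}" for b j
    by auto
  have defect_left: "kernel_defect q k l j = 0" if "j < z" for j
    using that
  proof (induction j)
    case 0
    then show ?case using z by (auto simp: k_def)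
  next
    case (Suc j)
    then have "l + int j + 1 \<noteq> 0"
      using z by linarith
    then show ?case using Suc by (simp add: k_def)
  qed
  \<comment> \<open>With zero defect, Cramer's rule multiplied by \<open>q i\<close> relates
    consecutive continuants by the factor \<open>q i * n (i + 1) / n i\<close>. The quotients of
    \<open>n\<close> telescope, up to \<open>n 0\<close> for \<open>j = z\<close>.\<close>
  have left: "continuant q l j * n l = (\<Prod>i\<in>{l..<l + int j}. q i) * n (l + int j)"
    if "j \<le> z" for j
    using that
  proof (induction j)
    case 0
    then show ?case by simp
  next
    case (Suc j)
    let ?i = "l + int j"
    have i: "l \<le> ?i" "?i \<le> r" "?i < 0"
      using Suc.prems z assms(2) by linarith+
    have "continuant q l (Suc j) * n ?i = q ?i * (continuant q l (Suc j) * m ?i)"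
      using q[OF i(1,2)] by (metis mult.left_commute)
    also have "\<dots> = q ?i * (n (?i + 1) * continuant q l j)"
      using solution[OF i(2)] defect_left Suc.prems by simp
    finally have "continuant q l (Suc j) * n l * n ?i =
        q ?i * n (?i + 1) * (continuant q l j * n l)"
      by (simp add: algebra_simps)
    also have "\<dots> = (q ?i * (\<Prod>i\<in>{l..<?i}. q i) * n (?i + 1)) * n ?i"
      using Suc by (simp add: algebra_simps)
    finally have "continuant q l (Suc j) * n l = q ?i * (\<Prod>i\<in>{l..<?i}. q i) * n (?i + 1)"
      using n[OF i(1,2)] by simp
    then show ?case
      unfolding upto by (simp add: add_ac)
  qed
  \<comment> \<open>The source sits at index \<open>z\<close>, that is, at abscissa 0. The bound
    \<open>0 + int e\<close> makes \<open>upto\<close> applicable.\<close>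
  have defect_right: "kernel_defect q k l (z + e) = continuant q l z * (\<Prod>i\<in>{0..<0 + int e}. q i)"
    for e
  proof (induction e)
    case 0
    show ?case
    proof (cases z)
      case 0
      then show ?thesis using z by (simp add: k_def)
    next
      case (Suc y)
      then have "l + int y + 1 = 0" using z by simp
      then show ?thesis using defect_left[of y] Suc by (simp add: k_def)
    qed
  next
    case (Suc e)
    have "l + int (z + e) = int e"
      using z by simp
    then have "kernel_defect q k l (z + Suc e) = q (int e) * kernel_defect q k l (z + e)"
      unfolding add_Suc_right kernel_defect.simps by (simp only:) (simp add: k_def)
    then show ?case
      unfolding upto Suc.IH by simp
  qed
  define e where "e = nat r"
  have e: "int e = r" "l + int (z + e) = r" "nat (r + 1 - l) = Suc (z + e)"
    using assms z by (auto simp: e_def)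
  \<comment> \<open>Multiplication by \<open>q r\<close> turns \<open>m r\<close> into
    \<open>n r\<close> and also supplies the missing last factor of the product.\<close>
  have "continuant q l (Suc (z + e)) * n r = q r * (continuant q l (Suc (z + e)) * m r)"
    using q[of r] assms(1,2) by (simp add: mult.left_commute)
  also have "\<dots> = q r * (continuant q l z * (\<Prod>i\<in>{0..<r}. q i))"
    using solution[of "z + e"] assms(7) unfolding e defect_right by simp
  finally have "continuant q l (Suc (z + e)) * (n l * n r) =
      q r * (\<Prod>i\<in>{0..<r}. q i) * (continuant q l z * n l)"
    by (simp add: algebra_simps)
  also have "\<dots> = n 0 * ((\<Prod>i\<in>{l..<0}. q i) * (q r * (\<Prod>i\<in>{0..<r}. q i)))"
    using left[of z] by (simp add: z)
  also have "q r * (\<Prod>i\<in>{0..<r}. q i) = (\<Prod>i\<in>insert r {0..<r}. q i)"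
    by simp
  also have "(\<Prod>i\<in>{l..<0}. q i) * (\<Prod>i\<in>insert r {0..<r}. q i) =
      (\<Prod>i\<in>{l..<0} \<union> insert r {0..<r}. q i)"
    by (rule prod.union_disjoint[symmetric]) (use assms(2) in auto)
  also have "{l..<0} \<union> insert r {0..<r} = {l..r}"
    using assms(1,2) by auto
  finally show ?thesis
    unfolding e(3) .
qed

section \<open>From vertical profiles to the product formula\<close>

text \<open>Positivity makes the support exactly \<open>{l..r}\<close>, so a profile amounts to a
  prescribed multiset of abscissae, the form that \<open>forests\<close> uses.\<close>

lemma has_vertical_profile_iff:
  fixes t :: "'a tree"
  assumes "l \<le> r" and "\<And>i. l \<le> i \<Longrightarrow> i \<le> r \<Longrightarrow> n i > 0"
  shows "has_vertical_profile t l r n \<longleftrightarrow> abscissae t = (\<Sum>i\<in>{l..r}. replicate_mset (n i) i)"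
    (is "_ \<longleftrightarrow> _ = ?N")
proof
  have count: "count ?N i = (if i \<in> {l..r} then n i else 0)" for i
    by (auto simp: count_sum)
  show "abscissae t = ?N" if t: "has_vertical_profile t l r n"
  proof (rule multiset_eqI)
    fix i
    have "l \<le> i \<and> i \<le> r" if "i \<in># abscissae t"
      using t that by (auto simp: has_vertical_profile_def)
    then show "count (abscissae t) i = count ?N i"
      using t unfolding count has_vertical_profile_def
      by (auto simp: count_eq_zero_iff)
  qed
  show "has_vertical_profile t l r n" if t: "abscissae t = ?N"
  proof -
    have "set_mset ?N = {l..r}"
      using assms(2) by (auto simp: set_mset_def count split: if_splits)
    moreover have "Min {l..r} = l" "Max {l..r} = r"
      using assms(1) by (auto intro: Min_eqI Max_eqI)
    moreover have "t \<noteq> Leaf"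
      using t calculation assms(1) by (auto simp: abscissae_def)
    ultimately show ?thesis
      by (simp add: has_vertical_profile_def t count)
  qed
qed

theorem theorem1p1:
  fixes l r :: int and n :: "int \<Rightarrow> nat"
  assumes "l \<le> 0" and "0 \<le> r"
    and "\<And>i. l \<le> i \<Longrightarrow> i \<le> r \<Longrightarrow> n i > 0"
    and "n (l - 1) = 0" and "n (r + 1) = 0"
  shows "finite {t :: unit tree. has_vertical_profile t l r n} \<and>
    real (card {t :: unit tree. has_vertical_profile t l r n}) =
      real (n 0) / (real (n l) * real (n r))
      * real ((n (-1) + n 1) choose (n 0 - 1))
      * (\<Prod>i\<in>{l..r} - {0}. real ((n (i - 1) + n (i + 1) - 1) choose (n i - 1)))"
proof -
  define N where "N = (\<Sum>i\<in>{l..r}. replicate_mset (n i) i)"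
  let ?T = "{t :: unit tree. has_vertical_profile t l r n}"
  have "forests [0] N = (\<lambda>t. [t]) ` {t. abscissae t = N}"
    by (auto simp: forests_def abscissae_def length_Suc_conv)
  moreover have "?T = {t. abscissae t = N}"
    unfolding N_def by (intro Collect_cong has_vertical_profile_iff) (use assms in auto)
  ultimately have T: "forests [0] N = (\<lambda>t. [t]) ` ?T"
    by simp
  have inj: "inj_on (\<lambda>t. [t]) ?T"
    by (auto intro: inj_onI)
  have count_N: "count N i = (if i \<in> {l..r} then n i else 0)" for i
    by (auto simp: N_def count_sum)
  \<comment> \<open>The range extends one step beyond \<open>{l..r}\<close> on both sides, since
    \<open>slots\<close> looks at both neighbours.\<close>
  have count: "count N i = n i" if "l - 1 \<le> i" "i \<le> r + 1" for i
  proof -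
    have "i = l - 1 \<or> i = r + 1 \<or> i \<in> {l..r}"
      using that by auto
    then show ?thesis
      using assms(4,5) by (auto simp: count_N)
  qed
  define m where "m = slots [0] N"
  have m: "m i = (if i = 0 then 1 else 0) + n (i - 1) + n (i + 1)" if "l \<le> i" "i \<le> r" for i
    using that by (simp add: m_def slots_def count)
  \<comment> \<open>Abscissa 0 has the initial slot; any other abscissa has an occupied neighbour on
    the side of 0.\<close>
  have m_pos: "m i > 0" if "l \<le> i" "i \<le> r" for i
  proof -
    consider "i = 0" | "i < 0" | "i > 0" by linarith
    then show ?thesis
    proof cases
      case 2
      then show ?thesis using m that assms(2) assms(3)[of "i + 1"] by simp
    next
      case 3
      then show ?thesis using m that assms(1) assms(3)[of "i - 1"] by simp
    qed (use m that in simp)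
  qed
  define q where "q = node_ratio [0] N"
  have q: "q i * real (m i) = real (n i)" if "l \<le> i" "i \<le> r" for i
    using m_pos[OF that] that by (simp add: q_def node_ratio_def m_def count)
  \<comment> \<open>The absorption identity: each factor \<open>q i\<close> of the determinant
    lowers both arguments of a binomial by one.\<close>
  have choose: "real (m i choose n i) * q i = real ((m i - 1) choose (n i - 1))"
    if "l \<le> i" "i \<le> r" for i
  proof -
    have "real (m i) * real ((m i - 1) choose (n i - 1)) = real (n i) * real (m i choose n i)"
      using Suc_times_binomial_eq[of "m i - 1" "n i - 1"] m_pos[OF that] assms(3)[OF that]
      by (simp flip: of_nat_mult add: mult.commute)
    also have "\<dots> = real (m i) * (real (m i choose n i) * q i)"
      using q[OF that] by (simp add: algebra_simps)
    finally show ?thesis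
      using m_pos[OF that] by simp
  qed
  have "continuant q l (nat (r + 1 - l)) * (real (n l) * real (n r)) =
      real (n 0) * (\<Prod>i\<in>{l..r}. q i)"
    by (rule continuant_single_source[where m = "\<lambda>i. real (m i)" and n = "\<lambda>i. real (n i)"])
      (use assms q in \<open>auto simp: m\<close>)
  moreover have "n l > 0" "n r > 0"
    using assms by auto
  ultimately have K: "continuant q l (nat (r + 1 - l)) =
      real (n 0) / (real (n l) * real (n r)) * (\<Prod>i\<in>{l..r}. q i)"
    by (simp add: field_simps)
  have I: "{l..<l + int (nat (r + 1 - l))} = {l..r}"
    using assms(1,2) by auto
  have "set_mset N \<subseteq> {l..r}"
    by (auto simp: set_mset_def count_N split: if_splits)
  then have "real (card (forests [0] N)) =
      (\<Prod>i\<in>{l..r}. real (m i choose count N i)) * continuant q l (nat (r + 1 - l))"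
    using card_forests[of N l "nat (r + 1 - l)" "[0]"] unfolding I m_def q_def by simp
  also have "\<dots> = real (n 0) / (real (n l) * real (n r)) *
      (\<Prod>i\<in>{l..r}. real (m i choose n i) * q i)"
    unfolding K prod.distrib by (simp add: count)
  also have "(\<Prod>i\<in>{l..r}. real (m i choose n i) * q i) =
      (\<Prod>i\<in>{l..r}. real ((m i - 1) choose (n i - 1)))"
    by (rule prod.cong) (auto simp: choose)
  also have "\<dots> = real ((m 0 - 1) choose (n 0 - 1)) *
      (\<Prod>i\<in>{l..r} - {0}. real ((m i - 1) choose (n i - 1)))"
    by (rule prod.remove) (use assms in auto)
  also have "(\<Prod>i\<in>{l..r} - {0}. real ((m i - 1) choose (n i - 1))) =
      (\<Prod>i\<in>{l..r} - {0}. real ((n (i - 1) + n (i + 1) - 1) choose (n i - 1)))"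
    by (rule prod.cong) (auto simp: m)
  \<comment> \<open>The initial slot offsets the \<open>- 1\<close>, which is why the factor at 0
    differs from the others.\<close>
  also have "m 0 - 1 = n (-1) + n 1"
    using m[of 0] assms by simp
  finally have "real (card ?T) = real (n 0) / (real (n l) * real (n r))
      * real ((n (-1) + n 1) choose (n 0 - 1))
      * (\<Prod>i\<in>{l..r} - {0}. real ((n (i - 1) + n (i + 1) - 1) choose (n i - 1)))"
    unfolding T card_image[OF inj] by simp
  moreover have "finite ?T"
    using finite_forests[of "[0]" N] unfolding T by (rule finite_imageD[OF _ inj])
  ultimately show ?thesis
    by blast
qed

end
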